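(* Let $d$ be a positive integer and $0<\varepsilon<1$. Let $K\subset\mathbb{R}^d$ be a compact set with nonempty interior. There exists a positive integer $n=n(K,\varepsilon)$ such that the following holds. If $\mathcal{F}$ is a finite family of convex sets in $\mathbb{R}^d$ such that the intersection of any $n$ or fewer sets of $\mathcal{F}$ contains a set of $\mathcal{W}_{\mathrm{iso}}(K)$ of volume $1$, then $\bigcap\mathcal{F}$ contains a set of $\mathcal{W}_{\mathrm{iso}}(K)$ of volume $1-\varepsilon$.
   Context: $O(d)$ is the group of orthogonal $d\times d$ matrices, and $AK=\{Ax: x\in K\}$. The family of scaled isometric copies of $K$ is $$\mathcal{W}_{\mathrm{iso}}(K)=\{a+\alpha AK : A\in O(d),\ \alpha\in\mathbb{R},\ a\in\mathbb{R}^d\}.$$ *)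

theory Defs
  imports "HOL-Analysis.Analysis"
begin

definition W_iso :: "(real ^ 'd) set \<Rightarrow> (real ^ 'd) set set" where
  "W_iso K = {(\<lambda>x. a + \<alpha> *\<^sub>R (A *v x)) ` K | a \<alpha> A. orthogonal_matrix A}"

end

theory Submission
  imports Defs
begin

text \<open>
  A copy of \<open>K\<close> of volume \<open>1\<close> has a scaling factor of fixed size \<open>s\<close>, so it is determined by a
  matrix \<open>A \<in> O(d)\<close> and a translation vector. For a fixed matrix the problem is Helly's theorem:
  the translation vectors \<open>a\<close> for which \<open>a + s A K\<close> lies in a convex set \<open>C\<close> form a convex set
  (\<open>convex_translations_into\<close>). What remains is to reduce the compact group \<open>O(d)\<close> to finitely many
  matrices, and the loss of volume \<open>\<epsilon>\<close> pays for this.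

  Let \<open>c < 1\<close> be the factor that turns volume \<open>1\<close> into \<open>1 - \<epsilon>\<close>. Because \<open>K\<close> contains a ball, a convex
  set that contains \<open>a + s A K\<close> also contains a translate of \<open>c s B K\<close> for each \<open>B\<close> close enough to
  \<open>A\<close> (\<open>shrunken_copy_in_convex\<close>); how close depends only on \<open>K\<close> and \<open>\<epsilon>\<close>. Take a finite net \<open>N\<close> of
  \<open>O(d)\<close> of this fineness. If \<open>\<Inter>\<F>\<close> contained no translate of \<open>c s B K\<close> for any \<open>B \<in> N\<close>, then Helly's
  theorem would give for each \<open>B\<close> a subfamily of at most \<open>d + 1\<close> sets witnessing this. The union of
  these witnesses has at most \<open>n = |N| (d + 1)\<close> members and rules out all \<open>B \<in> N\<close> at the same time
  (\<open>helly_finite_disjunction\<close>); but the intersection of these members contains a copy of volume \<open>1\<close>, hence a translate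
  of some \<open>c s B K\<close>, a contradiction.
\<close>

section \<open>Volume of isometric copies\<close>

text \<open>
  Balls carry the whole argument: an orthogonal map sends a ball to a translate of itself, and by
  Vitali's theorem disjoint balls inside an open set exhaust it up to a null set.
\<close>

lemma emeasure_open_le_orthogonal_image:
  fixes f :: "'a::euclidean_space \<Rightarrow> 'a"
  assumes f: "orthogonal_transformation f" and S: "open S"
  shows "emeasure lebesgue S \<le> emeasure lebesgue (f ` S)"
proof -
  let ?K = "{p :: 'a \<times> real. ball (fst p) (snd p) \<subseteq> S}"
  let ?B = "\<lambda>p :: 'a \<times> real. ball (fst p) (snd p)"
  have "\<exists>p. p \<in> ?K \<and> x \<in> ?B p \<and> snd p < d" if x: "x \<in> S" and "0 < d" for x d
  proof -
    obtain e where "e > 0" "ball x e \<subseteq> S"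
      using S x openE by blast
    then show ?thesis
      using \<open>0 < d\<close> by (intro exI[of _ "(x, min e (d / 2))"]) (auto simp: ball_min_Int)
  qed
  then obtain C where C: "countable C" "C \<subseteq> ?K"
      "pairwise (\<lambda>p q. disjnt (?B p) (?B q)) C" "negligible (S - (\<Union>p\<in>C. ?B p))"
    by (rule Vitali_covering_theorem_balls[of S ?K fst snd])
  have fB: "f ` ?B p = (+) (f (fst p) - fst p) ` ?B p" for p
    by (simp add: image_orthogonal_transformation_ball[OF f])
  have disj: "disjoint_family_on ?B C" "disjoint_family_on (\<lambda>p. f ` ?B p) C"
    using C(3) orthogonal_transformation_inj[OF f]
    by (auto simp: disjoint_family_on_def pairwise_def disjnt_def simp flip: image_Int)
  have B_sets: "(\<Union>p\<in>C. ?B p) \<in> sets lebesgue"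
    by (intro sets_completionI_sets) (auto intro!: borel_open open_UN)
  have "emeasure lebesgue S \<le> emeasure lebesgue ((\<Union>p\<in>C. ?B p) \<union> (S - (\<Union>p\<in>C. ?B p)))"
    using B_sets negligible_imp_sets[OF C(4)] by (intro emeasure_mono sets.Un) auto
  also have "\<dots> = emeasure lebesgue (\<Union>p\<in>C. ?B p)"
    using C(4) B_sets by (intro emeasure_Un_null_set) (simp_all only: negligible_iff_null_sets)
  also have "\<dots> = (\<integral>\<^sup>+p. emeasure lebesgue (?B p) \<partial>count_space C)"
    using C(1) disj by (intro emeasure_UN_countable) auto
  also have "\<dots> = (\<integral>\<^sup>+p. emeasure lebesgue (f ` ?B p) \<partial>count_space C)"
    using emeasure_lebesgue_affine[of 1 "f (fst p) - fst p" "?B p" for p]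
    by (simp only: fB) (simp add: add.commute cong: image_cong_simp)
  also have "\<dots> = emeasure lebesgue (\<Union>p\<in>C. f ` ?B p)"
    using C(1) disj
    by (intro emeasure_UN_countable[symmetric])
      (auto simp: image_orthogonal_transformation_ball[OF f])
  also have "\<dots> \<le> emeasure lebesgue (f ` S)"
    using C(2) open_surjective_linear_image[OF S orthogonal_transformation_linear[OF f]]
    by (intro emeasure_mono) (auto simp: orthogonal_transformation_surj[OF f])
  finally show ?thesis .
qed

text \<open>
  Applying the preceding inequality to a map and to its inverse settles open sets. Boxes follow
  since the boundary of a convex set is null, and boxes determine the effect of a linear map on volume.
\<close>

lemma measure_orthogonal_transformation_image:
  fixes f :: "'a::euclidean_space \<Rightarrow> 'a"
  assumes f: "orthogonal_transformation f" and S: "S \<in> lmeasurable"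
  shows "measure lebesgue (f ` S) = measure lebesgue S"
proof -
  have lin: "linear f" and inj: "inj f"
    using f orthogonal_transformation_linear orthogonal_transformation_inj by blast+
  have open_image: "emeasure lebesgue (f ` U) = emeasure lebesgue U" if "open U" for U
  proof (rule antisym)
    have "open (f ` U)"
      using that f open_surjective_linear_image orthogonal_transformation_linear
        orthogonal_transformation_surj by blast
    from emeasure_open_le_orthogonal_image[OF orthogonal_transformation_inv[OF f] this]
    show "emeasure lebesgue (f ` U) \<le> emeasure lebesgue U"
      using inj by (simp add: image_image)
  qed (rule emeasure_open_le_orthogonal_image[OF f that])
  have "measure lebesgue (f ` cbox a b) = 1 * measure lebesgue (cbox a b)" for a b
  proof -
    have "measure lebesgue (f ` cbox a b) = measure lebesgue (interior (f ` cbox a b))"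
      using lin by (intro measure_interior[symmetric] negligible_convex_frontier)
        (auto intro: convex_linear_image bounded_linear_image simp: linear_linear)
    also have "interior (f ` cbox a b) = f ` interior (cbox a b)"
      using lin inj by (rule interior_injective_linear_image)
    also have "measure lebesgue \<dots> = measure lebesgue (interior (cbox a b))"
      by (simp only: measure_def open_image open_interior)
    also have "\<dots> = measure lebesgue (cbox a b)"
      by (intro measure_interior negligible_convex_frontier) auto
    finally show ?thesis by simp
  qed
  from measure_linear_sufficient[OF lin S this] show ?thesis by simp
qed

lemma measure_similar_copy:
  fixes K :: "(real ^ 'd) set"
  assumes "orthogonal_matrix A" "K \<in> lmeasurable"
  shows "measure lebesgue ((\<lambda>x. a + \<alpha> *\<^sub>R (A *v x)) ` K) = \<bar>\<alpha>\<bar> ^ CARD('d) * measure lebesgue K"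
proof -
  have "orthogonal_transformation ((*v) A)"
    using assms by (simp add: orthogonal_transformation_matrix)
  then show ?thesis
    using measure_lebesgue_affine[of \<alpha> a "(*v) A ` K"]
      measure_orthogonal_transformation_image[OF _ assms(2)]
    by (simp add: image_image add.commute)
qed

section \<open>Finite nets in the orthogonal group\<close>

lemma compact_orthogonal_matrices: "compact {A :: real ^ 'd ^ 'd. orthogonal_matrix A}"
proof -
  have "\<bar>A $ i $ j\<bar> \<le> 1" if "orthogonal_matrix A" for A :: "real ^ 'd ^ 'd" and i j
    using that component_le_norm_cart[of "row i A" j]
    by (simp add: orthogonal_matrix_orthonormal_rows row_def vec_lambda_eta)
  then have row: "norm (A $ i) \<le> (\<Sum>j\<in>(UNIV::'d set). 1)"
    if "orthogonal_matrix A" for A :: "real ^ 'd ^ 'd" and i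
    using that by (intro order_trans[OF norm_le_l1_cart] sum_mono) auto
  have "norm A \<le> (\<Sum>i\<in>(UNIV::'d set). \<Sum>j\<in>(UNIV::'d set). 1)"
    if "orthogonal_matrix A" for A :: "real ^ 'd ^ 'd"
    unfolding norm_vec_def[of A] using row[OF that]
    by (intro order_trans[OF L2_set_le_sum sum_mono]) auto
  then have "bounded {A :: real ^ 'd ^ 'd. orthogonal_matrix A}"
    unfolding bounded_iff by blast
  moreover have "closed {A :: real ^ 'd ^ 'd. orthogonal_matrix A}"
    unfolding orthogonal_matrix matrix_matrix_mult_def transpose_def
    by (intro closed_Collect_eq continuous_intros) 
  ultimately show ?thesis
    by (simp add: compact_eq_bounded_closed)
qed

lemma norm_matrix_vector_mult_le:
  fixes A :: "real ^ 'n ^ 'm"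
  shows "norm (A *v x) \<le> real CARD('m) * real CARD('n) * norm A * norm x"
proof -
  have "\<bar>A $ i $ j\<bar> \<le> norm A" for i j
    using component_le_norm_cart[of "A $ i" j] Finite_Cartesian_Product.norm_nth_le[of A i] by linarith
  then have "onorm ((*v) A) \<le> real CARD('m) * real CARD('n) * norm A"
    by (rule onorm_le_matrix_component)
  then show ?thesis
    using onorm[of "(*v) A" x] by (meson matrix_vector_mul_bounded_linear mult_right_mono norm_ge_zero order_trans)
qed

text \<open>
  Closeness in the net is measured by the displacement of points of norm at most \<open>R\<close>, which is
  what the comparison of two rotated copies of a bounded set uses.
\<close>

lemma finite_net_orthogonal_matrices:
  fixes R \<delta> :: real
  assumes "0 < \<delta>"
  obtains N :: "(real ^ 'd ^ 'd) set"
  where "finite N" "N \<subseteq> {A. orthogonal_matrix A}"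
    "\<And>A. orthogonal_matrix A \<Longrightarrow>
      \<exists>B\<in>N. \<forall>x. norm x \<le> R \<longrightarrow> norm ((B - A) *v x) < \<delta>"
proof -
  \<comment> \<open>A bound for \<open>norm (M *v x) / norm M\<close> on the ball of radius \<open>R\<close>; the summand \<open>1\<close> keeps it
     positive whatever \<open>R\<close> is.\<close>
  define c where "c = real CARD('d) * real CARD('d) * (\<bar>R\<bar> + 1)"
  have "c > 0" by (simp add: c_def)
  obtain N :: "(real ^ 'd ^ 'd) set" where N: "finite N" "N \<subseteq> {A. orthogonal_matrix A}"
      "{A. orthogonal_matrix A} \<subseteq> (\<Union>B\<in>N. ball B (\<delta> / c))"
  proof (rule compactE_image[OF compact_orthogonal_matrices])
    show "{A :: real ^ 'd ^ 'd. orthogonal_matrix A} \<subseteq> (\<Union>B\<in>{A. orthogonal_matrix A}. ball B (\<delta> / c))"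
      using assms \<open>c > 0\<close> by auto
  qed auto
  show thesis
  proof (rule that[OF N(1,2)])
    fix A :: "real ^ 'd ^ 'd" assume "orthogonal_matrix A"
    then obtain B where B: "B \<in> N" "norm (B - A) < \<delta> / c"
      using N(3) by (auto simp: dist_norm)
    have "norm ((B - A) *v x) < \<delta>" if "norm x \<le> R" for x
    proof -
      have "norm ((B - A) *v x) \<le> real CARD('d) * real CARD('d) * norm (B - A) * norm x"
        by (rule norm_matrix_vector_mult_le)
      also have "\<dots> \<le> real CARD('d) * real CARD('d) * norm (B - A) * (\<bar>R\<bar> + 1)"
        using that by (intro mult_left_mono) auto
      also have "\<dots> = c * norm (B - A)" by (simp add: c_def)
      also have "\<dots> < \<delta>"
        using B \<open>c > 0\<close> by (simp add: field_simps)
      finally show ?thesis .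
    qed
    with B show "\<exists>B\<in>N. \<forall>x. norm x \<le> R \<longrightarrow> norm ((B - A) *v x) < \<delta>" by blast
  qed
qed

section \<open>Replacing a copy by a smaller one with a nearby orthogonal matrix\<close>

text \<open>
  The error made by using \<open>B\<close> in place of \<open>A\<close> is absorbed by the ball in \<open>K\<close>. For \<open>x \<in> K\<close> one looks
  for \<open>y\<close> with \<open>c B x + (1 - c) A x0 = c A x + (1 - c) A y\<close>. The solution differs from \<open>x0\<close> by
  \<open>c / (1 - c)\<close> times the image of \<open>(B - A) x\<close> under the inverse of \<open>A\<close>, so \<open>y\<close> lies in the ball around \<open>x0\<close>, and the left-hand
  side is, up to the map \<open>v \<mapsto> a + \<alpha> v\<close>, a convex combination of two points of the given copy.
\<close>

lemma shrunken_copy_in_convex: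
  fixes K C :: "(real ^ 'd) set"
  assumes A: "orthogonal_matrix A"
    and c: "0 < c" "c < 1"
    and ball: "ball x0 r \<subseteq> K"
    and near: "\<And>x. x \<in> K \<Longrightarrow> norm ((B - A) *v x) < (1 - c) * r"
    and C: "convex C" "(\<lambda>x. a + \<alpha> *\<^sub>R (A *v x)) ` K \<subseteq> C"
  shows "(\<lambda>x. (a + (\<alpha> * (1 - c)) *\<^sub>R (A *v x0)) + (c * \<alpha>) *\<^sub>R (B *v x)) ` K \<subseteq> C"
proof (rule image_subsetI)
  fix x assume x: "x \<in> K"
  define y where "y = x0 + (c / (1 - c)) *\<^sub>R (transpose A *v ((B - A) *v x))"
  have "orthogonal_transformation ((*v) (transpose A))"
    using A by (simp add: orthogonal_transformation_matrix)
  then have "norm (y - x0) = c / (1 - c) * norm ((B - A) *v x)"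
    using c by (simp add: y_def orthogonal_transformation)
  also have "\<dots> \<le> 1 / (1 - c) * norm ((B - A) *v x)"
    using c by (intro mult_right_mono divide_right_mono) auto
  also have "\<dots> < r"
    using near[OF x] c by (simp add: field_simps)
  finally have "y \<in> K"
    using ball by (auto simp: dist_norm norm_minus_commute)
  have "A *v (transpose A *v v) = v" for v
    using A by (simp only: matrix_vector_mul_assoc orthogonal_matrix_def matrix_vector_mul_lid)
  then have Ay: "A *v y = A *v x0 + (c / (1 - c)) *\<^sub>R ((B - A) *v x)"
    by (simp add: y_def matrix_vector_right_distrib matrix_vector_mult_scaleR)
  have "(1 - c) *\<^sub>R (A *v y) = (1 - c) *\<^sub>R (A *v x0) + c *\<^sub>R (B *v x) - c *\<^sub>R (A *v x)"
    using c by (simp add: Ay scaleR_right_distrib matrix_vector_mult_diff_rdistrib scaleR_right_diff_distrib)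
  then have eq: "c *\<^sub>R (A *v x) + (1 - c) *\<^sub>R (A *v y) = (1 - c) *\<^sub>R (A *v x0) + c *\<^sub>R (B *v x)"
    by simp
  have "c *\<^sub>R (a + \<alpha> *\<^sub>R (A *v x)) + (1 - c) *\<^sub>R (a + \<alpha> *\<^sub>R (A *v y))
      = a + \<alpha> *\<^sub>R (c *\<^sub>R (A *v x) + (1 - c) *\<^sub>R (A *v y))"
    by (simp add: algebra_simps)
  also have "\<dots> = (a + (\<alpha> * (1 - c)) *\<^sub>R (A *v x0)) + (c * \<alpha>) *\<^sub>R (B *v x)"
    unfolding eq by (simp add: algebra_simps)
  finally have eq2: "(a + (\<alpha> * (1 - c)) *\<^sub>R (A *v x0)) + (c * \<alpha>) *\<^sub>R (B *v x)
      = c *\<^sub>R (a + \<alpha> *\<^sub>R (A *v x)) + (1 - c) *\<^sub>R (a + \<alpha> *\<^sub>R (A *v y))" by (rule sym)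
  have "a + \<alpha> *\<^sub>R (A *v x) \<in> C" "a + \<alpha> *\<^sub>R (A *v y) \<in> C"
    using C(2) x \<open>y \<in> K\<close> by auto
  then show "(a + (\<alpha> * (1 - c)) *\<^sub>R (A *v x0)) + (c * \<alpha>) *\<^sub>R (B *v x) \<in> C"
    unfolding eq2 using c by (intro convexD[OF C(1)]) auto
qed

text \<open>
  The volume fixes the scaling factor up to sign, and the sign can be moved into the matrix since
  \<open>-A\<close> is orthogonal together with \<open>A\<close>.
\<close>

lemma unit_volume_copy_positive_scale:
  fixes K :: "(real ^ 'd) set"
  assumes "K \<in> lmeasurable" "W \<in> W_iso K" "measure lebesgue W = 1"
    and s: "0 < s" "s ^ CARD('d) * measure lebesgue K = 1"
  obtains a A where "orthogonal_matrix A" "W = (\<lambda>x. a + s *\<^sub>R (A *v x)) ` K"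
proof -
  obtain a \<alpha> A where A: "orthogonal_matrix A" and W: "W = (\<lambda>x. a + \<alpha> *\<^sub>R (A *v x)) ` K"
    using assms(2) by (auto simp: W_iso_def)
  have "\<bar>\<alpha>\<bar> ^ CARD('d) * measure lebesgue K = s ^ CARD('d) * measure lebesgue K"
    using assms(3) s measure_similar_copy[OF A assms(1)] by (simp add: W)
  then have "\<bar>\<alpha>\<bar> ^ CARD('d) = s ^ CARD('d)"
    using s by (metis mult_right_cancel mult_zero_right zero_neq_one)
  then have "\<bar>\<alpha>\<bar> = s"
    using s by (metis abs_ge_zero less_imp_le power_eq_imp_eq_base zero_less_card_finite)
  then consider "\<alpha> = s" | "\<alpha> = - s" by linarith
  then show thesis
  proof cases
    case 1
    with A W that show thesis by blast
  next
    case 2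
    have "(- A) *v x = - (A *v x)" for x
      by (simp add: matrix_vector_mult_def vec_eq_iff sum_negf)
    moreover have "orthogonal_matrix (- A)"
      using A by (simp add: orthogonal_matrix_def matrix_matrix_mult_def transpose_def vec_eq_iff)
    ultimately show thesis
      using that[of "- A" a] W 2 by simp
  qed
qed

section \<open>Helly's theorem with finitely many alternatives\<close>

text \<open>
  Indexing by an arbitrary set avoids counting: distinct indices may give the same set, and the
  family may have fewer than \<open>d + 1\<close> members.
\<close>

lemma helly_indexed:
  fixes S :: "'i \<Rightarrow> 'a::euclidean_space set"
  assumes F: "finite F" "\<And>i. i \<in> F \<Longrightarrow> convex (S i)"
    and sub: "\<And>G. G \<subseteq> F \<Longrightarrow> card G \<le> DIM('a) + 1 \<Longrightarrow> (\<Inter>i\<in>G. S i) \<noteq> {}"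
  shows "(\<Inter>i\<in>F. S i) \<noteq> {}"
proof -
  have small: "\<Inter>T \<noteq> {}" if T: "T \<subseteq> S ` F" "card T \<le> DIM('a) + 1" for T
  proof -
    obtain G where G: "G \<subseteq> F" "inj_on S G" "T = S ` G"
      using T(1) by (meson subset_image_inj)
    then show ?thesis
      using sub[OF G(1)] T(2) by (simp add: card_image)
  qed
  show ?thesis
  proof (cases "card (S ` F) \<le> DIM('a) + 1")
    case True
    then show ?thesis using small[of "S ` F"] by simp
  next
    case False
    show ?thesis
    proof (rule Helly)
      show "DIM('a) + 1 \<le> card (S ` F)" using False by simp
      show "\<forall>s\<in>S ` F. convex s" using F by blast
      show "\<Inter>t \<noteq> {}" if "t \<subseteq> S ` F" "card t = DIM('a) + 1" for t
        using small that by simp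
    qed
  qed
qed

text \<open>
  If every alternative \<open>b\<close> fails, Helly's theorem gives each of them a small witness of failure, and
  the union of these witnesses is a subfamily for which every alternative fails.
\<close>

lemma helly_finite_disjunction:
  fixes S :: "'b \<Rightarrow> 'i \<Rightarrow> 'a::euclidean_space set"
  assumes F: "finite F" and N: "finite N"
    and conv: "\<And>b i. b \<in> N \<Longrightarrow> i \<in> F \<Longrightarrow> convex (S b i)"
    and sub: "\<And>G. G \<subseteq> F \<Longrightarrow> card G \<le> card N * (DIM('a) + 1) \<Longrightarrow> \<exists>b\<in>N. (\<Inter>i\<in>G. S b i) \<noteq> {}"
  shows "\<exists>b\<in>N. (\<Inter>i\<in>F. S b i) \<noteq> {}"
proof (rule ccontr)
  assume none: "\<not> ?thesis"
  have "\<exists>G. G \<subseteq> F \<and> card G \<le> DIM('a) + 1 \<and> (\<Inter>i\<in>G. S b i) = {}" if "b \<in> N" for b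
  proof (rule ccontr)
    assume no_G: "\<not> ?thesis"
    have "(\<Inter>i\<in>F. S b i) \<noteq> {}"
    proof (rule helly_indexed[OF F])
      show "convex (S b i)" if "i \<in> F" for i
        using conv \<open>b \<in> N\<close> that .
      show "(\<Inter>i\<in>G. S b i) \<noteq> {}" if "G \<subseteq> F" "card G \<le> DIM('a) + 1" for G
        using no_G that by blast
    qed
    with none that show False by blast
  qed
  then have "\<forall>b\<in>N. \<exists>G. G \<subseteq> F \<and> card G \<le> DIM('a) + 1 \<and> (\<Inter>i\<in>G. S b i) = {}"
    by blast
  from bchoice[OF this] obtain G where
    G: "\<And>b. b \<in> N \<Longrightarrow> G b \<subseteq> F \<and> card (G b) \<le> DIM('a) + 1 \<and> (\<Inter>i\<in>G b. S b i) = {}"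
    by blast
  have "card (\<Union>b\<in>N. G b) \<le> (\<Sum>b\<in>N. card (G b))"
    using N by (rule card_UN_le)
  also have "\<dots> \<le> card N * (DIM('a) + 1)"
    using G sum_bounded_above[of N "\<lambda>b. card (G b)" "DIM('a) + 1"] by simp
  finally have "\<exists>b\<in>N. (\<Inter>i\<in>(\<Union>b\<in>N. G b). S b i) \<noteq> {}"
    using G by (intro sub UN_least) auto
  then obtain b where b: "b \<in> N" "(\<Inter>i\<in>(\<Union>b\<in>N. G b). S b i) \<noteq> {}"
    by (rule bexE)
  then have "(\<Inter>i\<in>(\<Union>b\<in>N. G b). S b i) \<subseteq> (\<Inter>i\<in>G b. S b i)"
    by (intro INT_anti_mono) auto
  with b G[of b] show False by simp
qed

lemma convex_translations_into:
  assumes "convex C"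
  shows "convex {a. (\<lambda>x. a + f x) ` K \<subseteq> C}"
proof (rule convexI)
  fix a b and u v :: real
  assume ab: "a \<in> {a. (\<lambda>x. a + f x) ` K \<subseteq> C}" "b \<in> {a. (\<lambda>x. a + f x) ` K \<subseteq> C}"
    and uv: "0 \<le> u" "0 \<le> v" "u + v = 1"
  have "u *\<^sub>R a + v *\<^sub>R b + f x = u *\<^sub>R (a + f x) + v *\<^sub>R (b + f x)" for x
    using uv scaleR_left_distrib[of u v "f x"] by (simp add: scaleR_right_distrib)
  then show "u *\<^sub>R a + v *\<^sub>R b \<in> {a. (\<lambda>x. a + f x) ` K \<subseteq> C}"
    using ab uv convexD[OF assms] by (auto simp: image_subset_iff)
qed

section \<open>Helly's theorem for scaled isometric copies\<close>

theorem theorem1p0p3: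
  fixes K :: "(real ^ 'd) set" and \<epsilon> :: real
  assumes "0 < \<epsilon>" and "\<epsilon> < 1"
    and "compact K" and "interior K \<noteq> {}"
  shows "\<exists>n::nat. n > 0 \<and>
    (\<forall>\<F> :: (real ^ 'd) set set.
       finite \<F> \<longrightarrow> (\<forall>C\<in>\<F>. convex C) \<longrightarrow>
       (\<forall>\<G>. \<G> \<subseteq> \<F> \<and> card \<G> \<le> n \<longrightarrow>
          (\<exists>W\<in>W_iso K. measure lebesgue W = 1 \<and> W \<subseteq> \<Inter>\<G>)) \<longrightarrow>
       (\<exists>W\<in>W_iso K. measure lebesgue W = 1 - \<epsilon> \<and> W \<subseteq> \<Inter>\<F>))"
proof -
  let ?d = "CARD('d)" and ?V = "measure lebesgue K"
  have K: "K \<in> lmeasurable"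
    using assms(3) by (rule lmeasurable_compact)
  have "\<not> negligible K"
    using assms(4) open_not_negligible[OF open_interior] interior_subset negligible_subset by metis
  then have V: "?V > 0"
    using K by (simp add: negligible_iff_measure zero_less_measure_iff)
  obtain x0 r where r: "r > 0" "ball x0 r \<subseteq> K"
    using assms(4) by (metis ex_in_conv mem_interior)
  obtain R where R: "\<And>x. x \<in> K \<Longrightarrow> norm x \<le> R"
    using compact_imp_bounded[OF assms(3)] unfolding bounded_iff by blast
  define s where "s = root ?d (1 / ?V)"
  define c where "c = root ?d (1 - \<epsilon>)"
  have s: "s > 0" "s ^ ?d * ?V = 1"
    using V by (simp_all add: s_def)
  have c: "0 < c" "c < 1" "c ^ ?d = 1 - \<epsilon>"
    using assms(1,2) by (simp_all add: c_def)
  obtain N :: "(real ^ 'd ^ 'd) set" where N: "finite N" "N \<subseteq> {A. orthogonal_matrix A}"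
      and net: "\<And>A. orthogonal_matrix A \<Longrightarrow>
        \<exists>B\<in>N. \<forall>x. norm x \<le> R \<longrightarrow> norm ((B - A) *v x) < (1 - c) * r"
  proof (rule finite_net_orthogonal_matrices[where R = R])
    show "0 < (1 - c) * r" using c r by simp
  qed blast
  define n where "n = card N * (?d + 1)"
  have "N \<noteq> {}"
    using net[OF orthogonal_matrix_id] by blast
  show ?thesis
  proof (intro exI[of _ n] conjI allI impI)
    show "n > 0"
      using N(1) \<open>N \<noteq> {}\<close> by (simp add: n_def card_gt_0_iff)
    fix \<F> :: "(real ^ 'd) set set"
    assume fin: "finite \<F>" and conv: "\<forall>C\<in>\<F>. convex C"
      and hyp: "\<forall>\<G>. \<G> \<subseteq> \<F> \<and> card \<G> \<le> n \<longrightarrow>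
          (\<exists>W\<in>W_iso K. measure lebesgue W = 1 \<and> W \<subseteq> \<Inter>\<G>)"
    define S where "S B C = {a. (\<lambda>x. a + (c * s) *\<^sub>R (B *v x)) ` K \<subseteq> C}" for B and C :: "(real ^ 'd) set"
    have "\<exists>B\<in>N. (\<Inter>C\<in>\<F>. S B C) \<noteq> {}"
    proof (rule helly_finite_disjunction[OF fin N(1)])
      show "convex (S B C)" if "C \<in> \<F>" for B C
        unfolding S_def using conv that by (intro convex_translations_into) auto
      fix \<G> assume \<G>: "\<G> \<subseteq> \<F>" "card \<G> \<le> card N * (DIM(real ^ 'd) + 1)"
      then obtain W where W: "W \<in> W_iso K" "measure lebesgue W = 1" "W \<subseteq> \<Inter>\<G>"
        using hyp by (auto simp: n_def)
      obtain a A where A: "orthogonal_matrix A" and Weq: "W = (\<lambda>x. a + s *\<^sub>R (A *v x)) ` K"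
        using unit_volume_copy_positive_scale[OF K W(1,2) s] by blast
      obtain B where B: "B \<in> N" "\<And>x. x \<in> K \<Longrightarrow> norm ((B - A) *v x) < (1 - c) * r"
        using net[OF A] R by blast
      have "a + (s * (1 - c)) *\<^sub>R (A *v x0) \<in> S B C" if "C \<in> \<G>" for C
        unfolding S_def using shrunken_copy_in_convex[OF A c(1,2) r(2) B(2), of C a s] W(3) Weq that conv \<G>(1)
        by blast
      then show "\<exists>B\<in>N. (\<Inter>C\<in>\<G>. S B C) \<noteq> {}"
        using B(1) by blast
    qed
    then obtain B a where B: "B \<in> N" "\<And>C. C \<in> \<F> \<Longrightarrow> a \<in> S B C" by blast
    let ?W = "(\<lambda>x. a + (c * s) *\<^sub>R (B *v x)) ` K"
    have oB: "orthogonal_matrix B" using B(1) N(2) by blast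
    show "\<exists>W\<in>W_iso K. measure lebesgue W = 1 - \<epsilon> \<and> W \<subseteq> \<Inter>\<F>"
    proof (intro bexI[of _ ?W] conjI)
      show "?W \<in> W_iso K" using oB unfolding W_iso_def by blast
      have "measure lebesgue ?W = c ^ ?d * (s ^ ?d * ?V)"
        using measure_similar_copy[OF oB K, of a "c * s"] c s by (simp add: power_mult_distrib)
      then show "measure lebesgue ?W = 1 - \<epsilon>"
        using c s by simp
      show "?W \<subseteq> \<Inter>\<F>" using B(2) unfolding S_def by blast
    qed
  qed
qed

end
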